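(* Let $M,D,K\in\mathbb{C}^{n\times n}$ be Hermitian positive definite, let $C_p\in\mathbb{C}^{m\times n}$ and $B_u=C_p^{\mathsf H}\in\mathbb{C}^{n\times m}$, and suppose the system has no velocity output and Rayleigh damping $D=\alpha M+\beta K$ with $\alpha,\beta\geq0$. Let $G(s)=C_p(s^2M+sD+K)^{-1}B_u$ be its transfer function. Let $s_1,\dots,s_N\in\mathbb{R}$ and $\xi_1,\dots,\xi_N\in\mathbb{R}$ satisfy the admissibility conditions stated in the context, and let $\mathbb{M},\mathbb{K}\in\mathbb{C}^{mN\times mN}$, $\mathbb{B}_u\in\mathbb{C}^{mN\times m}$, $\mathbb{C}_p\in\mathbb{C}^{m\times mN}$ be the data matrices built from the evaluations of $G$ (and its derivative) as described in the context. Let $r\geq1$ be such that the $r$ largest singular values of $\mathbb{M}$ are positive, and let $(\widetilde M,\widetilde D,\widetilde K,\widetilde B_u,\widetilde C_p)$ be the order-$r$ model computed by quadrature-based second-order position-velocity balanced truncation (described in the context) from these data matrices. Then the reduced-order system $$\widetilde M\ddot{\widetilde x}(t)+\widetilde D\dot{\widetilde x}(t)+\widetilde K\widetilde x(t)=\widetilde B_uu(t),\qquad \widetilde y(t)=\widetilde C_p\widetilde x(t)$$ is asymptotically stable, i.e., all $\lambda\in\mathbb{C}$ with $\det(\lambda^2\widetilde M+\lambda\widetilde D+\widetilde K)=0$ satisfy $\operatorname{Re}\lambda<0$.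
   Context: Here $\mathrm{i}$ is the imaginary unit and $(\cdot)^{\mathsf H}$ is the conjugate transpose. Put $$\Phi(s)=s^2M+sD+K,\quad d(s)=1+\beta s,\quad n(s)=s^2+\alpha s,\quad h(s)=\frac{n(s)}{d(s)}.$$ Admissibility conditions: for all $j,k\in\{1,\dots,N\}$, $d(\mathrm{i}s_j)\neq0$, $d(-\mathrm{i}s_k)\neq0$; $\Phi(\mathrm{i}s_j)$ and $\Phi(-\mathrm{i}s_k)$ are nonsingular; $h(-\mathrm{i}s_k)\neq h(\mathrm{i}s_j)$ whenever $\mathrm{i}s_j\neq-\mathrm{i}s_k$; and $h'(\mathrm{i}s_j)\neq0$ whenever $\mathrm{i}s_j=-\mathrm{i}s_k$. (The right quadrature nodes are $\mathrm{i}s_j$, the left ones $-\mathrm{i}s_k$, and both rules have weights $\xi_i^2$.) Data matrices: with $X_{[k,j]}$ denoting the $m\times m$ block in block row $k$ and block column $j$ (and $X_{[k,:]}$, $X_{[:,j]}$ block rows and block columns of size $m$), $$\mathbb{M}_{[k,j]}=\begin{cases}\displaystyle-\frac{\xi_k\xi_j}{d(\mathrm{i}s_j)^2}\,\frac{(dG)'(\mathrm{i}s_j)}{h'(\mathrm{i}s_j)}&\text{if }\mathrm{i}s_j=-\mathrm{i}s_k,\\[3mm]\displaystyle-\frac{\xi_k\xi_j}{d(-\mathrm{i}s_k)d(\mathrm{i}s_j)}\,\frac{d(-\mathrm{i}s_k)G(-\mathrm{i}s_k)-d(\mathrm{i}s_j)G(\mathrm{i}s_j)}{h(-\mathrm{i}s_k)-h(\mathrm{i}s_j)}&\text{otherwise},\end{cases}$$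 $$\mathbb{K}_{[k,j]}=\begin{cases}\displaystyle\frac{\xi_k\xi_j}{d(\mathrm{i}s_j)^2}\,\frac{(nG)'(\mathrm{i}s_j)}{h'(\mathrm{i}s_j)}&\text{if }\mathrm{i}s_j=-\mathrm{i}s_k,\\[3mm]\displaystyle\frac{\xi_k\xi_j}{d(-\mathrm{i}s_k)d(\mathrm{i}s_j)}\,\frac{n(-\mathrm{i}s_k)G(-\mathrm{i}s_k)-n(\mathrm{i}s_j)G(\mathrm{i}s_j)}{h(-\mathrm{i}s_k)-h(\mathrm{i}s_j)}&\text{otherwise},\end{cases}$$ $$(\mathbb{B}_u)_{[k,:]}=\xi_kG(-\mathrm{i}s_k),\qquad(\mathbb{C}_p)_{[:,j]}=\xi_jG(\mathrm{i}s_j),$$ where $(dG)'$ and $(nG)'$ are the derivatives of $s\mapsto d(s)G(s)$ and $s\mapsto n(s)G(s)$. Quadrature-based second-order position-velocity balanced truncation of order $r$: compute a singular value decomposition $$\mathbb{M}=\begin{bmatrix}\check U_1&\check U_2\end{bmatrix}\begin{bmatrix}\check\Sigma_1&0\\0&\check\Sigma_2\end{bmatrix}\begin{bmatrix}\check Y_1^{\mathsf H}\\ \check Y_2^{\mathsf H}\end{bmatrix},$$ where $\check\Sigma_1\in\mathbb{R}^{r\times r}$ is diagonal and contains the $r$ largest singular values, and set $$\widetilde M=I_r,\quad\widetilde K=\check\Sigma_1^{-1/2}\check U_1^{\mathsf H}\mathbb{K}\check Y_1\check\Sigma_1^{-1/2},\quad\widetilde D=\alpha I_r+\beta\widetilde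 K,\quad\widetilde B_u=\check\Sigma_1^{-1/2}\check U_1^{\mathsf H}\mathbb{B}_u,\quad\widetilde C_p=\mathbb{C}_p\check Y_1\check\Sigma_1^{-1/2}.$$ *)

theory Defs
  imports
    "HOL-Analysis.Derivative"
    "Jordan_Normal_Form.Schur_Decomposition"
    "Jordan_Normal_Form.Gauss_Jordan_Elimination"
    "Jordan_Normal_Form.Determinant"
begin

definition hermitian_pos_def :: "nat \<Rightarrow> complex mat \<Rightarrow> bool" where
  "hermitian_pos_def n A \<longleftrightarrow>
     A \<in> carrier_mat n n \<and> mat_adjoint A = A \<and>
     (\<forall>v \<in> carrier_vec n. v \<noteq> 0\<^sub>v n \<longrightarrow> Re ((A *\<^sub>v v) \<bullet>c v) > 0)"

definition unitary_mat :: "nat \<Rightarrow> complex mat \<Rightarrow> bool" where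
  "unitary_mat n U \<longleftrightarrow>
     U \<in> carrier_mat n n \<and> mat_adjoint U * U = 1\<^sub>m n \<and> U * mat_adjoint U = 1\<^sub>m n"

text \<open>A system \<open>M x'' + D x' + K x = B u\<close>, \<open>y = C x\<close> without velocity output.\<close>

record so_system =
  mass :: "complex mat"
  damping :: "complex mat"
  stiffness :: "complex mat"
  input_mat :: "complex mat"
  output_mat :: "complex mat"

definition pencil :: "so_system \<Rightarrow> complex \<Rightarrow> complex mat" where
  "pencil S s = s\<^sup>2 \<cdot>\<^sub>m mass S + s \<cdot>\<^sub>m damping S + stiffness S"

text \<open>The value is meaningful only where the pencil is nonsingular; elsewhere
  \<^const>\<open>mat_inverse\<close> returns \<^const>\<open>None\<close>.\<close>

definition transfer_function :: "so_system \<Rightarrow> complex \<Rightarrow> complex mat" where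
  "transfer_function S s = output_mat S * the (mat_inverse (pencil S s)) * input_mat S"

definition asymptotically_stable :: "so_system \<Rightarrow> bool" where
  "asymptotically_stable S \<longleftrightarrow> (\<forall>z. det (pencil S z) = 0 \<longrightarrow> Re z < 0)"

definition d_fun :: "real \<Rightarrow> complex \<Rightarrow> complex" where
  "d_fun \<beta> s = 1 + of_real \<beta> * s"

definition n_fun :: "real \<Rightarrow> complex \<Rightarrow> complex" where
  "n_fun \<alpha> s = s\<^sup>2 + of_real \<alpha> * s"

definition h_fun :: "real \<Rightarrow> real \<Rightarrow> complex \<Rightarrow> complex" where
  "h_fun \<alpha> \<beta> s = n_fun \<alpha> s / d_fun \<beta> s"

text \<open>Quadrature nodes and weights are indexed from \<open>0\<close> to \<open>N - 1\<close>.\<close>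

definition right_node :: "(nat \<Rightarrow> real) \<Rightarrow> nat \<Rightarrow> complex" where
  "right_node s j = \<i> * of_real (s j)"

definition left_node :: "(nat \<Rightarrow> real) \<Rightarrow> nat \<Rightarrow> complex" where
  "left_node s k = - (\<i> * of_real (s k))"

definition admissible :: "real \<Rightarrow> real \<Rightarrow> so_system \<Rightarrow> nat \<Rightarrow> (nat \<Rightarrow> real) \<Rightarrow> bool" where
  "admissible \<alpha> \<beta> S N s \<longleftrightarrow>
     (\<forall>j<N. \<forall>k<N.
        d_fun \<beta> (right_node s j) \<noteq> 0 \<and> d_fun \<beta> (left_node s k) \<noteq> 0 \<and>
        invertible_mat (pencil S (right_node s j)) \<and>
        invertible_mat (pencil S (left_node s k)) \<and>
        (right_node s j \<noteq> left_node s k \<longrightarrow>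
           h_fun \<alpha> \<beta> (left_node s k) \<noteq> h_fun \<alpha> \<beta> (right_node s j)) \<and>
        (right_node s j = left_node s k \<longrightarrow> deriv (h_fun \<alpha> \<beta>) (right_node s j) \<noteq> 0))"

definition mat_deriv :: "(complex \<Rightarrow> complex mat) \<Rightarrow> complex \<Rightarrow> complex mat" where
  "mat_deriv F s =
     Matrix.mat (dim_row (F s)) (dim_col (F s)) (\<lambda>(a, b). deriv (\<lambda>z. F z $$ (a, b)) s)"

text \<open>The matrix with \<open>p\<close> block rows and \<open>q\<close> block columns whose blocks \<open>X k j\<close> are \<open>m \<times> m\<close>.\<close>

definition block_mat :: "nat \<Rightarrow> nat \<Rightarrow> nat \<Rightarrow> (nat \<Rightarrow> nat \<Rightarrow> complex mat) \<Rightarrow> complex mat" where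
  "block_mat m p q X =
     Matrix.mat (m * p) (m * q) (\<lambda>(a, b). X (a div m) (b div m) $$ (a mod m, b mod m))"

definition data_M ::
  "real \<Rightarrow> real \<Rightarrow> nat \<Rightarrow> nat \<Rightarrow> (nat \<Rightarrow> real) \<Rightarrow> (nat \<Rightarrow> real) \<Rightarrow> (complex \<Rightarrow> complex mat) \<Rightarrow> complex mat"
where
  "data_M \<alpha> \<beta> m N s \<xi> G = block_mat m N N (\<lambda>k j.
     let d = d_fun \<beta>; h = h_fun \<alpha> \<beta>; \<mu> = left_node s k; \<nu> = right_node s j;
         w = complex_of_real (\<xi> k * \<xi> j)
     in if \<nu> = \<mu>
        then (- w / (d \<nu>)\<^sup>2 * (1 / deriv h \<nu>)) \<cdot>\<^sub>m mat_deriv (\<lambda>z. d z \<cdot>\<^sub>m G z) \<nu>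
        else (- w / (d \<mu> * d \<nu>) * (1 / (h \<mu> - h \<nu>))) \<cdot>\<^sub>m (d \<mu> \<cdot>\<^sub>m G \<mu> - d \<nu> \<cdot>\<^sub>m G \<nu>))"

definition data_K ::
  "real \<Rightarrow> real \<Rightarrow> nat \<Rightarrow> nat \<Rightarrow> (nat \<Rightarrow> real) \<Rightarrow> (nat \<Rightarrow> real) \<Rightarrow> (complex \<Rightarrow> complex mat) \<Rightarrow> complex mat"
where
  "data_K \<alpha> \<beta> m N s \<xi> G = block_mat m N N (\<lambda>k j.
     let d = d_fun \<beta>; n = n_fun \<alpha>; h = h_fun \<alpha> \<beta>; \<mu> = left_node s k; \<nu> = right_node s j;
         w = complex_of_real (\<xi> k * \<xi> j)
     in if \<nu> = \<mu>
        then (w / (d \<nu>)\<^sup>2 * (1 / deriv h \<nu>)) \<cdot>\<^sub>m mat_deriv (\<lambda>z. n z \<cdot>\<^sub>m G z) \<nu>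
        else (w / (d \<mu> * d \<nu>) * (1 / (h \<mu> - h \<nu>))) \<cdot>\<^sub>m (n \<mu> \<cdot>\<^sub>m G \<mu> - n \<nu> \<cdot>\<^sub>m G \<nu>))"

definition data_B :: "nat \<Rightarrow> nat \<Rightarrow> (nat \<Rightarrow> real) \<Rightarrow> (nat \<Rightarrow> real) \<Rightarrow> (complex \<Rightarrow> complex mat) \<Rightarrow> complex mat" where
  "data_B m N s \<xi> G = block_mat m N 1 (\<lambda>k _. of_real (\<xi> k) \<cdot>\<^sub>m G (left_node s k))"

definition data_C :: "nat \<Rightarrow> nat \<Rightarrow> (nat \<Rightarrow> real) \<Rightarrow> (nat \<Rightarrow> real) \<Rightarrow> (complex \<Rightarrow> complex mat) \<Rightarrow> complex mat" where
  "data_C m N s \<xi> G = block_mat m 1 N (\<lambda>_ j. of_real (\<xi> j) \<cdot>\<^sub>m G (right_node s j))"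

text \<open>\<open>A = U diag(\<sigma>\<^sub>0, \<dots>, \<sigma>\<^sub>p\<^sub>-\<^sub>1) Y\<^sup>H\<close> is a singular value decomposition of a \<open>p \<times> p\<close> matrix
  whose first \<open>r\<close> singular values are \<open>r\<close> largest ones; no order is imposed among the first
  \<open>r\<close>, nor among the remaining ones.\<close>

definition is_svd ::
  "nat \<Rightarrow> nat \<Rightarrow> complex mat \<Rightarrow> complex mat \<Rightarrow> (nat \<Rightarrow> real) \<Rightarrow> complex mat \<Rightarrow> bool" where
  "is_svd p r A U \<sigma> Y \<longleftrightarrow>
     unitary_mat p U \<and> unitary_mat p Y \<and>
     A = U * mat_diag p (\<lambda>i. of_real (\<sigma> i)) * mat_adjoint Y \<and>
     (\<forall>i<p. 0 \<le> \<sigma> i) \<and>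
     (\<forall>i<r. \<forall>j. r \<le> j \<and> j < p \<longrightarrow> \<sigma> j \<le> \<sigma> i)"

definition first_cols :: "nat \<Rightarrow> complex mat \<Rightarrow> complex mat" where
  "first_cols r A = Matrix.mat (dim_row A) r (\<lambda>(i, j). A $$ (i, j))"

definition bt_model ::
  "real \<Rightarrow> real \<Rightarrow> nat \<Rightarrow> complex mat \<Rightarrow> (nat \<Rightarrow> real) \<Rightarrow> complex mat \<Rightarrow>
   complex mat \<Rightarrow> complex mat \<Rightarrow> complex mat \<Rightarrow> so_system" where
  "bt_model \<alpha> \<beta> r U \<sigma> Y KK BB CC =
     (let S = mat_diag r (\<lambda>i. complex_of_real (\<sigma> i powr (- 1 / 2)));
          U1 = first_cols r U;
          Y1 = first_cols r Y;
          Kr = S * mat_adjoint U1 * KK * Y1 * S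
      in \<lparr> mass = 1\<^sub>m r,
           damping = of_real \<alpha> \<cdot>\<^sub>m 1\<^sub>m r + of_real \<beta> \<cdot>\<^sub>m Kr,
           stiffness = Kr,
           input_mat = S * mat_adjoint U1 * BB,
           output_mat = CC * Y1 * S \<rparr>)"

end

theory Submission
  imports Defs
begin

text \<open>Rayleigh damping gives \<open>\<Phi>(z) = n(z) M + d(z) K\<close>, so the resolvent identity turns the divided
  differences (and, in the limit, the derivatives) of \<open>d G\<close> and \<open>n G\<close> into
  \<open>C\<^sub>p \<Phi>(\<mu>)\<^sup>-\<^sup>1 M \<Phi>(\<nu>)\<^sup>-\<^sup>1 C\<^sub>p\<^sup>H\<close> and \<open>C\<^sub>p \<Phi>(\<mu>)\<^sup>-\<^sup>1 K \<Phi>(\<nu>)\<^sup>-\<^sup>1 C\<^sub>p\<^sup>H\<close>. The left nodes are the conjugates of the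
  right ones, hence \<open>\<Phi>(\<mu>\<^sub>k)\<^sup>-\<^sup>1 = (\<Phi>(\<nu>\<^sub>k)\<^sup>-\<^sup>1)\<^sup>H\<close> and the data matrices are \<open>V\<^sup>H M V\<close> and \<open>V\<^sup>H K V\<close> with the
  same \<open>V\<close>. As \<open>V\<^sup>H M V\<close> is positive semidefinite, its left and right singular vectors for positive
  singular values coincide, so truncation is a congruence with \<open>W = V Y\<^sub>1 \<Sigma>\<^sub>1\<^sup>-\<^sup>1\<^sup>/\<^sup>2\<close>, and
  \<open>W\<^sup>H M W = I\<close>.\<close>

section \<open>Adjoints, congruences and singular values\<close>

lemma dim_mat_adjoint [simp]:
  "dim_row (mat_adjoint A) = dim_col A" "dim_col (mat_adjoint A) = dim_row A"
  by (simp_all add: mat_adjoint_def)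

lemma mat_adjoint_carrier [simp]:
  "A \<in> carrier_mat nr nc \<Longrightarrow> mat_adjoint A \<in> carrier_mat nc nr"
  by (intro carrier_matI) auto

lemma index_mat_adjoint [simp]:
  "i < dim_col A \<Longrightarrow> j < dim_row A \<Longrightarrow> mat_adjoint A $$ (i, j) = conjugate (A $$ (j, i))"
  by (simp add: mat_adjoint_def mat_of_rows_def)

lemma mat_adjoint_adjoint [simp]: "mat_adjoint (mat_adjoint A) = A"
  by (rule eq_matI) auto

lemma mat_adjoint_add:
  "A \<in> carrier_mat nr nc \<Longrightarrow> B \<in> carrier_mat nr nc \<Longrightarrow>
    mat_adjoint (A + B) = mat_adjoint A + mat_adjoint B"
  by (rule eq_matI) (auto simp: conjugate_dist_add)

lemma mat_adjoint_smult: "mat_adjoint (c \<cdot>\<^sub>m A) = conjugate c \<cdot>\<^sub>m mat_adjoint A"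
  by (rule eq_matI) (auto simp: conjugate_dist_mul)

lemma mat_adjoint_one [simp]: "mat_adjoint (1\<^sub>m n) = (1\<^sub>m n :: complex mat)"
  by (rule eq_matI) auto

lemma mat_adjoint_mult:
  fixes A B :: "complex mat"
  assumes "A \<in> carrier_mat nr k" "B \<in> carrier_mat k nc"
  shows "mat_adjoint (A * B) = mat_adjoint B * mat_adjoint A"
  using assms by (intro eq_matI) (auto simp: scalar_prod_def mult.commute intro!: sum.cong)

lemma mat_adjoint_diag_of_real:
  "mat_adjoint (mat_diag n (\<lambda>i. complex_of_real (f i))) = mat_diag n (\<lambda>i. complex_of_real (f i))"
  by (rule eq_matI) (auto simp: mat_diag_def)

lemma cscalar_prod_adjoint:
  fixes A :: "complex mat"
  assumes "A \<in> carrier_mat nr nc" "v \<in> carrier_vec nc" "w \<in> carrier_vec nr"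
  shows "(A *\<^sub>v v) \<bullet>c w = v \<bullet>c (mat_adjoint A *\<^sub>v w)"
proof -
  have "(A *\<^sub>v v) \<bullet>c w = (\<Sum>i<nr. \<Sum>j<nc. A $$ (i, j) * v $ j * cnj (w $ i))"
    using assms by (auto simp: scalar_prod_def sum_distrib_right atLeast0LessThan intro!: sum.cong)
  also have "\<dots> = (\<Sum>j<nc. \<Sum>i<nr. A $$ (i, j) * v $ j * cnj (w $ i))"
    by (rule sum.swap)
  also have "\<dots> = v \<bullet>c (mat_adjoint A *\<^sub>v w)"
    using assms by (auto simp: scalar_prod_def sum_distrib_left atLeast0LessThan
        mult.assoc mult.left_commute intro!: sum.cong)
  finally show ?thesis .
qed

lemma first_cols_carrier [simp]:
  "A \<in> carrier_mat n p \<Longrightarrow> first_cols r A \<in> carrier_mat n r"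
  by (simp add: first_cols_def)

lemma col_first_cols:
  "A \<in> carrier_mat n p \<Longrightarrow> r \<le> p \<Longrightarrow> i < r \<Longrightarrow> col (first_cols r A) i = col A i"
  by (rule eq_vecI) (auto simp: first_cols_def)

text \<open>\<open>hermitian_pos_def\<close> constrains only the real part of the form.
  Self-adjointness makes the form equal to its own conjugate, so it is a positive real number and
  can serve as a coefficient of a real quadratic.\<close>

lemma hermitian_pos_def_form:
  assumes "hermitian_pos_def n A" "v \<in> carrier_vec n" "v \<noteq> 0\<^sub>v n"
  obtains a where "0 < a" "(A *\<^sub>v v) \<bullet>c v = complex_of_real a"
proof -
  have A: "A \<in> carrier_mat n n" "mat_adjoint A = A"
    using assms(1) by (auto simp: hermitian_pos_def_def)
  have "cnj ((A *\<^sub>v v) \<bullet>c v) = v \<bullet>c (A *\<^sub>v v)"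
    using A assms(2) by (auto simp: scalar_prod_def mult.commute intro!: sum.cong)
  also have "\<dots> = (A *\<^sub>v v) \<bullet>c v"
    using cscalar_prod_adjoint[of A n n v v] A assms(2) by simp
  finally have "(A *\<^sub>v v) \<bullet>c v = complex_of_real (Re ((A *\<^sub>v v) \<bullet>c v))"
    by (simp add: complex_eq_iff)
  with assms show thesis
    by (intro that) (auto simp: hermitian_pos_def_def)
qed

text \<open>Moving \<open>mat_adjoint W\<close> across the inner product turns a form on the reduced
  space into the original form evaluated at \<open>W *\<^sub>v v\<close>.\<close>

lemma congruence_form_eq:
  fixes A W :: "complex mat"
  assumes "A \<in> carrier_mat n n" "W \<in> carrier_mat n r" "v \<in> carrier_vec r"
  shows "((mat_adjoint W * A * W) *\<^sub>v v) \<bullet>c v = (A *\<^sub>v (W *\<^sub>v v)) \<bullet>c (W *\<^sub>v v)"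
proof -
  have "(mat_adjoint W * A * W) *\<^sub>v v = mat_adjoint W *\<^sub>v (A *\<^sub>v (W *\<^sub>v v))"
    using assms mult_carrier_mat[of "mat_adjoint W" r n A n]
    by (simp add: assoc_mult_mat_vec[of _ r n _ r] assoc_mult_mat_vec[of _ r n _ n])
  with cscalar_prod_adjoint[of "mat_adjoint W" r n "A *\<^sub>v (W *\<^sub>v v)" v] assms show ?thesis
    by simp
qed

text \<open>At a real root the terms with \<open>a\<close> and \<open>c\<close> have a positive sum,
  so \<open>b * Re z\<close> must be negative. At a nonreal root, dividing the imaginary part of the
  equation by \<open>Im z\<close> leaves \<open>2 * a * Re z = - b\<close>.\<close>

lemma Re_root_neg_if_pos_coeffs:
  fixes z :: complex
  assumes "0 < a" "0 < b" "0 < c" and z: "of_real a * z\<^sup>2 + of_real b * z + of_real c = 0"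
  shows "Re z < 0"
proof (cases "Im z = 0")
  case True
  then have "a * (Re z)\<^sup>2 + b * Re z + c = 0"
    using arg_cong[OF z, of Re] by (simp add: power2_eq_square)
  moreover have "0 \<le> a * (Re z)\<^sup>2" using assms by simp
  ultimately have "b * Re z < 0" using assms by linarith
  then show ?thesis using assms by (simp add: mult_less_0_iff)
next
  case False
  have "Im z * (2 * a * Re z + b) = 0"
    using arg_cong[OF z, of Im] by (simp add: power2_eq_square algebra_simps)
  with False have "2 * (a * Re z) = - b" by simp
  then have "a * Re z < 0" using assms by linarith
  then show ?thesis using assms by (simp add: mult_less_0_iff)
qed

text \<open>Both \<open>M y\<^sub>i = \<sigma>\<^sub>i u\<^sub>i\<close> and \<open>M u\<^sub>i = \<sigma>\<^sub>i y\<^sub>i\<close>, so \<open>u\<^sub>i - y\<^sub>i\<close> would be an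
  eigenvector for \<open>-\<sigma>\<^sub>i < 0\<close>.\<close>

lemma svd_psd_singular_vectors_eq:
  assumes svd: "is_svd p r A U \<sigma> Y" and herm: "mat_adjoint A = A"
    and psd: "\<And>v. v \<in> carrier_vec p \<Longrightarrow> 0 \<le> Re ((A *\<^sub>v v) \<bullet>c v)"
    and i: "i < p" "0 < \<sigma> i"
  shows "col U i = col Y i"
proof -
  let ?S = "mat_diag p (\<lambda>i. complex_of_real (\<sigma> i))"
  have U: "U \<in> carrier_mat p p" "mat_adjoint U * U = 1\<^sub>m p"
    and Y: "Y \<in> carrier_mat p p" "mat_adjoint Y * Y = 1\<^sub>m p"
    and A: "A = U * ?S * mat_adjoint Y"
    using svd by (auto simp: is_svd_def unitary_mat_def)
  have Ac: "A \<in> carrier_mat p p" using U Y by (auto simp: A intro!: mult_carrier_mat)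
  \<comment> \<open>Stated for arbitrary \<open>X\<close> and \<open>Z\<close> because it serves
    twice, with the roles of \<open>U\<close> and \<open>Y\<close> exchanged.\<close>
  have cancel: "X * ?S * mat_adjoint Z * Z = X * ?S"
    if "X \<in> carrier_mat p p" "Z \<in> carrier_mat p p" "mat_adjoint Z * Z = 1\<^sub>m p" for X Z
  proof -
    have "X * ?S \<in> carrier_mat p p"
      using that by (intro mult_carrier_mat) auto
    with that show ?thesis
      by (simp only: assoc_mult_mat[of _ p p _ p _ p] mat_adjoint_carrier right_mult_one_mat)
  qed
  have AY: "A * Y = U * ?S"
    unfolding A using U Y by (intro cancel)
  \<comment> \<open>The adjoint of the decomposition is again a decomposition of the self-adjoint
    \<open>A\<close>, with left and right singular vectors exchanged.\<close>
  have "A = Y * ?S * mat_adjoint U"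
  proof -
    have "mat_adjoint A = Y * (?S * mat_adjoint U)"
      using U Y mult_carrier_mat[of U p p ?S p] unfolding A
      by (simp add: mat_adjoint_mult[of _ p p _ p] mat_adjoint_diag_of_real)
    with herm show ?thesis
      using U Y assoc_mult_mat[of Y p p ?S p "mat_adjoint U" p] by simp
  qed
  then have AU: "A * U = Y * ?S"
    using U Y cancel by simp
  have colS: "col (B * ?S) i = of_real (\<sigma> i) \<cdot>\<^sub>v col B i" if "B \<in> carrier_mat p p" for B
    using that i by (intro eq_vecI) (auto simp: mat_diag_mult_right[of _ p p])
  let ?w = "col U i - col Y i"
  have cols: "col U i \<in> carrier_vec p" "col Y i \<in> carrier_vec p"
    using U Y col_dim[of U i] col_dim[of Y i] by simp_all
  then have w: "?w \<in> carrier_vec p" by simp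
  have "A *\<^sub>v ?w = col (A * U) i - col (A * Y) i"
    unfolding col_mult2[OF Ac U(1) i(1)] col_mult2[OF Ac Y(1) i(1)]
    by (rule mult_minus_distrib_mat_vec[OF Ac cols])
  also have "\<dots> = of_real (- \<sigma> i) \<cdot>\<^sub>v ?w"
    unfolding AU AY using U Y i by (intro eq_vecI) (auto simp: colS algebra_simps)
  finally have "(A *\<^sub>v ?w) \<bullet>c ?w = of_real (- \<sigma> i) * (?w \<bullet>c ?w)"
    using w by simp
  with psd[OF w] have "\<sigma> i * Re (?w \<bullet>c ?w) \<le> 0" by simp
  then have "Re (?w \<bullet>c ?w) \<le> 0" using i by (simp add: mult_le_0_iff)
  \<comment> \<open>In the order on the complex numbers this also says that the imaginary part
    vanishes, so a nonpositive real part forces the value 0.\<close>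
  moreover have "0 \<le> ?w \<bullet>c ?w" by (rule conjugate_square_ge_0_vec)
  ultimately have "?w \<bullet>c ?w = 0"
    by (simp add: less_eq_complex_def complex_eq_iff)
  then have "?w = 0\<^sub>v p" using w by simp
  then have "?w $ k = 0" if "k < p" for k
    using that by simp
  then show ?thesis
    using cols U Y by (intro eq_vecI) auto
qed

text \<open>Reduces identities between congruences to comparing columns; both the singular value
  decomposition and the block structure of the data are handled this way.\<close>

lemma index_sesquilinear_mult:
  fixes A P Q :: "complex mat"
  assumes "A \<in> carrier_mat n n" "P \<in> carrier_mat n p" "Q \<in> carrier_mat n q" "i < p" "j < q"
  shows "(mat_adjoint P * A * Q) $$ (i, j) = (A *\<^sub>v col Q j) \<bullet>c col P i"
proof -
  have "mat_adjoint P * A * Q = mat_adjoint P * (A * Q)"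
    using assms by (intro assoc_mult_mat[of _ p n _ n _ q]) auto
  moreover have "row (mat_adjoint P) i = conjugate (col P i)"
    using assms by (intro eq_vecI) auto
  ultimately have "(mat_adjoint P * A * Q) $$ (i, j) = conjugate (col P i) \<bullet> col (A * Q) j"
    using assms by simp
  also have "\<dots> = col (A * Q) j \<bullet>c col P i"
    using assms by (intro comm_scalar_prod[of _ n]) auto
  finally show ?thesis
    using col_mult2[OF assms(1,3,5)] by simp
qed

text \<open>By associativity, truncating the data matrix by \<open>T\<close> amounts to one
  congruence of the original matrix by \<open>V * T\<close>.\<close>

lemma congruence_mult:
  fixes A V T :: "complex mat"
  assumes "A \<in> carrier_mat n n" "V \<in> carrier_mat n p" "T \<in> carrier_mat p q"
  shows "mat_adjoint (V * T) * A * (V * T) = mat_adjoint T * (mat_adjoint V * A * V) * T"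
proof -
  have VA: "mat_adjoint V * A \<in> carrier_mat p n"
    using assms by (intro mult_carrier_mat) auto
  have "mat_adjoint (V * T) * A = mat_adjoint T * (mat_adjoint V * A)"
    using assms by (simp add: mat_adjoint_mult[of _ n p] assoc_mult_mat[of _ q p _ n _ n])
  then have "mat_adjoint (V * T) * A * (V * T) = mat_adjoint T * ((mat_adjoint V * A) * (V * T))"
    using assms VA assoc_mult_mat[of "mat_adjoint T" q p "mat_adjoint V * A" n "V * T" q]
      mult_carrier_mat[of V n p T q] by simp
  also have "(mat_adjoint V * A) * (V * T) = mat_adjoint V * A * V * T"
    using assms(2,3) VA by (simp add: assoc_mult_mat[of _ p n _ p _ q])
  also have "mat_adjoint T * (mat_adjoint V * A * V * T) = mat_adjoint T * (mat_adjoint V * A * V) * T"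
    using assms VA mult_carrier_mat[of "mat_adjoint V * A" p n V p]
    by (simp add: assoc_mult_mat[of _ q p _ p _ q])
  finally show ?thesis .
qed

text \<open>Entry (i, j) is the form of \<open>A\<close> at the singular vectors
  \<open>y\<^sub>j\<close> and \<open>u\<^sub>i\<close>. Since \<open>A\<close> maps
  \<open>y\<^sub>j\<close> to \<open>\<sigma>\<^sub>j u\<^sub>j\<close>, orthonormality of the
  columns of \<open>U\<close> leaves only the diagonal.\<close>

lemma svd_first_singular_values:
  assumes svd: "is_svd p r A U \<sigma> Y" and r: "r \<le> p"
  shows "mat_adjoint (first_cols r U) * A * first_cols r Y = mat_diag r (\<lambda>i. of_real (\<sigma> i))"
proof (rule eq_matI)
  let ?S = "mat_diag p (\<lambda>i. complex_of_real (\<sigma> i))"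
  have U: "U \<in> carrier_mat p p" "mat_adjoint U * U = 1\<^sub>m p"
    and Y: "Y \<in> carrier_mat p p" "mat_adjoint Y * Y = 1\<^sub>m p"
    and A: "A = U * ?S * mat_adjoint Y"
    using svd by (auto simp: is_svd_def unitary_mat_def)
  have US: "U * ?S \<in> carrier_mat p p" using U by (intro mult_carrier_mat) auto
  then have Ac: "A \<in> carrier_mat p p" using Y mult_carrier_mat[OF US, of "mat_adjoint Y" p] by (simp add: A)
  have AY: "A * Y = U * ?S"
    using Y US by (simp only: A assoc_mult_mat[of _ p p _ p _ p] mat_adjoint_carrier
      right_mult_one_mat)
  fix i j
  assume "i < dim_row (mat_diag r (\<lambda>i. complex_of_real (\<sigma> i)))"
    "j < dim_col (mat_diag r (\<lambda>i. complex_of_real (\<sigma> i)))"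
  then have ij: "i < r" "j < r" by (simp_all add: mat_diag_def)
  have "(mat_adjoint (first_cols r U) * A * first_cols r Y) $$ (i, j)
      = (A *\<^sub>v col Y j) \<bullet>c col U i"
    using index_sesquilinear_mult[of A p "first_cols r U" r "first_cols r Y" r i j] Ac U Y ij r
      col_first_cols[of U p p r i] col_first_cols[of Y p p r j] by simp
  also have "A *\<^sub>v col Y j = col (U * ?S) j"
    using AY col_mult2[OF Ac Y(1), of j] ij r by simp
  also have "\<dots> = of_real (\<sigma> j) \<cdot>\<^sub>v col U j"
    using U ij r by (intro eq_vecI) (auto simp: mat_diag_mult_right[of _ p p])
  also have "(of_real (\<sigma> j) \<cdot>\<^sub>v col U j) \<bullet>c col U i = of_real (\<sigma> j) * (col U j \<bullet>c col U i)"
    using U by simp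
  \<comment> \<open>The identity matrix is inserted so that \<open>index_sesquilinear_mult\<close>
    also covers the Gram matrix of \<open>U\<close>.\<close>
  also have "col U j \<bullet>c col U i = (mat_adjoint U * 1\<^sub>m p * U) $$ (i, j)"
    using index_sesquilinear_mult[of "1\<^sub>m p" p U p U p i j] U ij r col_dim[of U j] by simp
  also have "\<dots> = (1\<^sub>m p) $$ (i, j)"
    using U right_mult_one_mat[of "mat_adjoint U" p p] by simp
  finally show "(mat_adjoint (first_cols r U) * A * first_cols r Y) $$ (i, j)
      = mat_diag r (\<lambda>i. of_real (\<sigma> i)) $$ (i, j)"
    using ij r by (auto simp: mat_diag_def)
qed (use assms in \<open>auto simp: first_cols_def mat_diag_def\<close>)

text \<open>\<open>V\<close> need not be injective, so definiteness of \<open>A\<close> survives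
  only as semidefiniteness; the case of a vanishing \<open>V *\<^sub>v v\<close> is
  separate.\<close>

lemma hermitian_pos_def_congruence_psd:
  assumes "hermitian_pos_def n A" "V \<in> carrier_mat n p" "v \<in> carrier_vec p"
  shows "0 \<le> Re (((mat_adjoint V * A * V) *\<^sub>v v) \<bullet>c v)"
proof -
  have A: "A \<in> carrier_mat n n" using assms(1) by (simp add: hermitian_pos_def_def)
  have Vv: "V *\<^sub>v v \<in> carrier_vec n" using assms by simp
  have "0 \<le> Re ((A *\<^sub>v (V *\<^sub>v v)) \<bullet>c (V *\<^sub>v v))"
  proof (cases "V *\<^sub>v v = 0\<^sub>v n")
    case True
    then show ?thesis using A by simp
  next
    case False
    with Vv assms(1) show ?thesis by (auto simp: hermitian_pos_def_def less_imp_le)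
  qed
  then show ?thesis using congruence_form_eq[OF A assms(2,3)] by simp
qed

lemma mat_adjoint_congruence:
  fixes A V :: "complex mat"
  assumes "A \<in> carrier_mat n n" "mat_adjoint A = A" "V \<in> carrier_mat n p"
  shows "mat_adjoint (mat_adjoint V * A * V) = mat_adjoint V * A * V"
proof -
  have V: "mat_adjoint V \<in> carrier_mat p n" using assms by simp
  then have VA: "mat_adjoint V * A \<in> carrier_mat p n" using assms by (intro mult_carrier_mat)
  show ?thesis
    unfolding mat_adjoint_mult[OF VA assms(3)] mat_adjoint_mult[OF V assms(1)]
    using assms assoc_mult_mat[OF V assms(1,3)] by simp
qed

text \<open>Since \<open>W\<^sup>H M W = I\<close>, the reduced pencil is \<open>W\<^sup>H (z\<^sup>2 M + z D + K) W\<close>; a kernel vector \<open>v\<close>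
  makes \<open>z\<close> a root of the real quadratic with the positive coefficients \<open>\<langle>M W v, W v\<rangle>\<close>,
  \<open>\<langle>D W v, W v\<rangle>\<close>, \<open>\<langle>K W v, W v\<rangle>\<close>.\<close>

lemma asymptotically_stable_congruence:
  assumes M: "hermitian_pos_def n M" and D: "hermitian_pos_def n D" and K: "hermitian_pos_def n K"
    and Deq: "D = of_real \<alpha> \<cdot>\<^sub>m M + of_real \<beta> \<cdot>\<^sub>m K"
    and W: "W \<in> carrier_mat n r" and WM: "mat_adjoint W * M * W = 1\<^sub>m r"
    and mass: "mass S = 1\<^sub>m r"
    and stiff: "stiffness S = mat_adjoint W * K * W"
    and damp: "damping S = of_real \<alpha> \<cdot>\<^sub>m 1\<^sub>m r + of_real \<beta> \<cdot>\<^sub>m stiffness S"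
  shows "asymptotically_stable S"
  unfolding asymptotically_stable_def
proof (intro allI impI)
  fix z assume det: "det (pencil S z) = 0"
  let ?K = "mat_adjoint W * K * W"
  have car: "M \<in> carrier_mat n n" "D \<in> carrier_mat n n" "K \<in> carrier_mat n n"
    using M D K by (auto simp: hermitian_pos_def_def)
  have Kc: "?K \<in> carrier_mat r r"
    using car W mult_carrier_mat[of "mat_adjoint W" r n K n] by (intro mult_carrier_mat) auto
  have Pc: "pencil S z \<in> carrier_mat r r"
    using Kc by (auto simp: pencil_def mass damp stiff)
  with det obtain v where v: "v \<in> carrier_vec r" "v \<noteq> 0\<^sub>v r" "pencil S z *\<^sub>v v = 0\<^sub>v r"
    using det_0_iff_vec_prod_zero by blast
  let ?w = "W *\<^sub>v v"
  have w: "?w \<in> carrier_vec n" using W v by simp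
  \<comment> \<open>The normalization \<open>WM\<close> makes \<open>W\<close> injective: a
    vanishing image would force the norm of \<open>v\<close> to be 0.\<close>
  have "?w \<noteq> 0\<^sub>v n"
  proof
    assume "?w = 0\<^sub>v n"
    then have "v \<bullet>c v = 0"
      using congruence_form_eq[OF car(1) W v(1)] WM v car by simp
    with v show False by simp
  qed
  with M D K w obtain a b c where pos: "0 < a" "0 < b" "0 < c"
    and forms: "(M *\<^sub>v ?w) \<bullet>c ?w = of_real a" "(D *\<^sub>v ?w) \<bullet>c ?w = of_real b"
      "(K *\<^sub>v ?w) \<bullet>c ?w = of_real c"
    by (metis hermitian_pos_def_form)
  have smult_mv: "(k \<cdot>\<^sub>m A) *\<^sub>v x = k \<cdot>\<^sub>v (A *\<^sub>v x)"
    if "A \<in> carrier_mat q q" "x \<in> carrier_vec q" for k :: complex and A x q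
    using that by (intro eq_vecI) (auto simp: row_smult)
  have add_sp: "(x + y) \<bullet>c u = x \<bullet>c u + y \<bullet>c u"
    if "x \<in> carrier_vec q" "y \<in> carrier_vec q" "u \<in> carrier_vec q" for x y u :: "complex vec" and q
    using that by (intro add_scalar_prod_distrib[of _ q]) auto
  have smult_sp: "(k \<cdot>\<^sub>v x) \<bullet>c u = k * (x \<bullet>c u)"
    if "x \<in> carrier_vec q" "u \<in> carrier_vec q" for k :: complex and x u q
    using that by (intro smult_scalar_prod_distrib[of _ q]) auto
  \<comment> \<open>Rayleigh damping identifies the damping coefficient of the reduced quadratic
    with the form of the full matrix \<open>D\<close>, whose definiteness has already made
    \<open>b\<close> positive.\<close>
  have b: "of_real b = of_real \<alpha> * of_real a + of_real \<beta> * complex_of_real c"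
    unfolding forms[symmetric] Deq using car w
    by (simp add: add_mult_distrib_mat_vec[of _ n n] smult_mv[of _ n] add_sp[of _ n] smult_sp[of _ n])
  have va: "v \<bullet>c v = of_real a"
    using congruence_form_eq[OF car(1) W v(1)] WM v forms by simp
  have vc: "(?K *\<^sub>v v) \<bullet>c v = of_real c"
    using congruence_form_eq[OF car(3) W v(1)] forms by simp
  have "0 = (pencil S z *\<^sub>v v) \<bullet>c v" using v by simp
  also have "\<dots> = z\<^sup>2 * (v \<bullet>c v) + z * (of_real \<alpha> * (v \<bullet>c v) + of_real \<beta> * ((?K *\<^sub>v v) \<bullet>c v))
      + (?K *\<^sub>v v) \<bullet>c v"
    unfolding pencil_def mass damp stiff using Kc v(1)
    by (simp add: add_mult_distrib_mat_vec[of _ r r] smult_mv[of _ r] add_sp[of _ r] smult_sp[of _ r])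
  also have "\<dots> = of_real a * z\<^sup>2 + of_real b * z + of_real c"
    unfolding va vc b by (simp add: algebra_simps)
  finally show "Re z < 0"
    using Re_root_neg_if_pos_coeffs[OF pos] by simp
qed

text \<open>Column \<open>c\<close> of \<open>V\<close> is column \<open>c mod m\<close> of
  \<open>X (c div m)\<close>, so an entry of the block matrix and the same entry of the congruence
  are one form at the same two columns.\<close>

lemma block_mat_congruence:
  fixes A :: "complex mat" and X :: "nat \<Rightarrow> complex mat"
  assumes A: "A \<in> carrier_mat n n" and X: "\<And>j. j < N \<Longrightarrow> X j \<in> carrier_mat n m"
    and V: "V = Matrix.mat n (m * N) (\<lambda>(i, b). X (b div m) $$ (i, b mod m))"
    and Z: "\<And>k j. k < N \<Longrightarrow> j < N \<Longrightarrow> Z k j = mat_adjoint (X k) * A * X j"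
  shows "block_mat m N N Z = mat_adjoint V * A * V"
proof (rule eq_matI)
  have Vc: "V \<in> carrier_mat n (m * N)" by (simp add: V)
  show "dim_row (block_mat m N N Z) = dim_row (mat_adjoint V * A * V)"
    "dim_col (block_mat m N N Z) = dim_col (mat_adjoint V * A * V)"
    using Vc by (auto simp: block_mat_def)
  fix a b assume "a < dim_row (mat_adjoint V * A * V)" "b < dim_col (mat_adjoint V * A * V)"
  then have ab: "a < m * N" "b < m * N" using Vc by auto
  \<comment> \<open>An index below \<open>m * N\<close> exists only for positive \<open>m\<close>,
    which is what the bound on the remainder requires.\<close>
  have div: "c div m < N" "c mod m < m" if "c < m * N" for c
    using that by (auto simp: less_mult_imp_div_less mult.commute intro!: mod_less_divisor gr0I)
  have col: "col V c = col (X (c div m)) (c mod m)" if "c < m * N" for c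
    using that div[OF that] X[of "c div m"] by (intro eq_vecI) (auto simp: V)
  have "block_mat m N N Z $$ (a, b)
      = (mat_adjoint (X (a div m)) * A * X (b div m)) $$ (a mod m, b mod m)"
    using ab div Z by (simp add: block_mat_def)
  also have "\<dots> = (A *\<^sub>v col V b) \<bullet>c col V a"
    using ab div X A by (simp add: col index_sesquilinear_mult[of _ n _ m _ m])
  also have "\<dots> = (mat_adjoint V * A * V) $$ (a, b)"
    using ab A Vc by (intro index_sesquilinear_mult[symmetric])
  finally show "block_mat m N N Z $$ (a, b) = (mat_adjoint V * A * V) $$ (a, b)" .
qed

section \<open>Inverses of matrix-valued functions\<close>

text \<open>By the Leibniz formula the determinant is a polynomial in the entries.\<close>

lemma tendsto_det:
  fixes A :: "complex mat"
  assumes F: "\<And>z. F z \<in> carrier_mat n n" and A: "A \<in> carrier_mat n n"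
    and lim: "\<And>i j. i < n \<Longrightarrow> j < n \<Longrightarrow> ((\<lambda>z. F z $$ (i, j)) \<longlongrightarrow> A $$ (i, j)) X"
  shows "((\<lambda>z. det (F z)) \<longlongrightarrow> det A) X"
  unfolding det_def'[OF F] det_def'[OF A]
proof (intro tendsto_sum tendsto_mult tendsto_const tendsto_prod)
  fix p i assume "p \<in> {p. p permutes {0..<n}}" "i \<in> {0..<n}"
  then have "i < n" "p i < n" using permutes_in_image[of p "{0..<n}" i] by auto
  then show "((\<lambda>z. F z $$ (i, p i)) \<longlongrightarrow> A $$ (i, p i)) X" by (rule lim)
qed

text \<open>Entries of the adjugate are signed minors, that is, determinants of size
  \<open>n - 1\<close>.\<close>

lemma tendsto_adj_mat:
  fixes A :: "complex mat"
  assumes F: "\<And>z. F z \<in> carrier_mat n n" and A: "A \<in> carrier_mat n n"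
    and lim: "\<And>i j. i < n \<Longrightarrow> j < n \<Longrightarrow> ((\<lambda>z. F z $$ (i, j)) \<longlongrightarrow> A $$ (i, j)) X"
    and ij: "i < n" "j < n"
  shows "((\<lambda>z. adj_mat (F z) $$ (i, j)) \<longlongrightarrow> adj_mat A $$ (i, j)) X"
proof -
  have dims: "dim_row (F z) = n" "dim_col (F z) = n" "dim_row A = n" "dim_col A = n" for z
    using F[of z] A by auto
  have "((\<lambda>z. det (mat_delete (F z) j i)) \<longlongrightarrow> det (mat_delete A j i)) X"
    by (rule tendsto_det[of _ "n - 1"])
      (auto simp: mat_delete_def dims intro!: mat_delete_carrier[OF F] mat_delete_carrier[OF A] lim)
  then show ?thesis
    using ij by (auto simp: adj_mat_def dims cofactor_def intro!: tendsto_intros)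
qed

lemma invertible_mat_imp_det_nonzero:
  fixes A :: "complex mat"
  assumes "A \<in> carrier_mat n n" "invertible_mat A"
  shows "det A \<noteq> 0"
proof -
  from assms obtain B where AB: "A * B = 1\<^sub>m n" "B * A = 1\<^sub>m (dim_row B)"
    by (auto simp: invertible_mat_def inverts_mat_def)
  \<comment> \<open>\<open>invertible_mat\<close> does not fix the shape of the inverse; it is read
    off from the column counts of both products.\<close>
  have "dim_col B = n" "dim_row B = n"
    using assms(1) arg_cong[OF AB(1), of dim_col] arg_cong[OF AB(2), of dim_col] by simp_all
  then have "B \<in> carrier_mat n n" by (intro carrier_matI)
  then have "det A * det B = 1"
    using det_mult[OF assms(1)] AB(1) by (metis det_one)
  then show ?thesis by auto
qed

text \<open>The last claim is Cramer's rule. It expresses the computed inverse through determinants,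
  whose limits are known.\<close>

lemma mat_inverse_det_nonzero:
  fixes A :: "complex mat"
  assumes A: "A \<in> carrier_mat n n" and det: "det A \<noteq> 0"
  shows "the (mat_inverse A) \<in> carrier_mat n n" (is "?R \<in> _")
    and "A * the (mat_inverse A) = 1\<^sub>m n"
    and "the (mat_inverse A) * A = 1\<^sub>m n"
    and "\<And>i j. i < n \<Longrightarrow> j < n \<Longrightarrow> the (mat_inverse A) $$ (i, j) = adj_mat A $$ (i, j) / det A"
proof -
  \<comment> \<open>A nonzero determinant makes \<open>A\<close> a unit, which rules out the result
    \<open>None\<close>.\<close>
  from mat_inverse(1)[OF A, of "()"] det_non_zero_imp_unit[OF A det, of "()"]
  obtain R where R: "mat_inverse A = Some R" by (cases "mat_inverse A") auto
  note inv = mat_inverse(2)[OF A R]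
  with R show "?R \<in> carrier_mat n n" "A * ?R = 1\<^sub>m n" "?R * A = 1\<^sub>m n" by auto
  fix i j assume ij: "i < n" "j < n"
  have "adj_mat A = R * A * adj_mat A" using inv adj_mat(1)[OF A] by simp
  also have "\<dots> = R * (A * adj_mat A)"
    using inv A adj_mat(1)[OF A] by (intro assoc_mult_mat) auto
  also have "\<dots> = R * (det A \<cdot>\<^sub>m 1\<^sub>m n)"
    by (simp only: adj_mat(2)[OF A])
  also have "\<dots> = det A \<cdot>\<^sub>m R"
    using inv mult_smult_distrib[of R n n "1\<^sub>m n" n "det A"] right_mult_one_mat[of R n n] by simp
  finally have "adj_mat A = det A \<cdot>\<^sub>m R" .
  moreover have "dim_row R = n" "dim_col R = n" using inv by auto
  ultimately show "?R $$ (i, j) = adj_mat A $$ (i, j) / det A"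
    using R ij det by simp
qed

text \<open>The adjoint of the inverse is a right inverse of the adjoint, and inverses are
  unique.\<close>

lemma mat_inverse_adjoint:
  fixes A :: "complex mat"
  assumes A: "A \<in> carrier_mat n n" "det A \<noteq> 0" "det (mat_adjoint A) \<noteq> 0"
  shows "the (mat_inverse (mat_adjoint A)) = mat_adjoint (the (mat_inverse A))"
proof -
  let ?R = "the (mat_inverse A)" and ?Q = "the (mat_inverse (mat_adjoint A))"
  have A': "mat_adjoint A \<in> carrier_mat n n" using A by simp
  note R = mat_inverse_det_nonzero[OF A(1,2)] and Q = mat_inverse_det_nonzero[OF A' A(3)]
  have "mat_adjoint A * mat_adjoint ?R = 1\<^sub>m n"
    using mat_adjoint_mult[OF R(1) A(1)] R(3) by simp
  then have "?Q = ?Q * (mat_adjoint A * mat_adjoint ?R)" using Q(1) by simp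
  also have "\<dots> = (?Q * mat_adjoint A) * mat_adjoint ?R"
    using A' Q(1) R(1) by (intro assoc_mult_mat[symmetric, of _ n n _ n _ n]) auto
  also have "\<dots> = mat_adjoint ?R" using Q(3) R(1) by simp
  finally show ?thesis .
qed

section \<open>Resolvents and divided differences of the transfer function\<close>

lemma index_mult3:
  fixes P Q R :: "complex mat"
  assumes "P \<in> carrier_mat p n" "Q \<in> carrier_mat n k" "R \<in> carrier_mat k q" "a < p" "b < q"
  shows "(P * Q * R) $$ (a, b) = (\<Sum>l<k. (\<Sum>i<n. P $$ (a, i) * Q $$ (i, l)) * R $$ (l, b))"
  using assms by (auto simp: scalar_prod_def atLeast0LessThan simp del: assoc_mult_mat intro!: sum.cong)

text \<open>With \<open>P\<close> and \<open>Q\<close> inverse to \<open>A\<close> and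
  \<open>B\<close>, the product \<open>P * B * Q\<close> collapses to \<open>P\<close> and
  \<open>P * A * Q\<close> to \<open>Q\<close>. The weights are arbitrary, so \<open>d\<close> and
  \<open>n\<close> are both covered.\<close>

lemma resolvent_identity:
  fixes A B P Q :: "complex mat"
  assumes c: "A \<in> carrier_mat n n" "B \<in> carrier_mat n n" "P \<in> carrier_mat n n" "Q \<in> carrier_mat n n"
    and PA: "P * A = 1\<^sub>m n" and BQ: "B * Q = 1\<^sub>m n"
  shows "a \<cdot>\<^sub>m P - b \<cdot>\<^sub>m Q = P * (a \<cdot>\<^sub>m B - b \<cdot>\<^sub>m A) * Q"
proof -
  have "P * (a \<cdot>\<^sub>m B - b \<cdot>\<^sub>m A) = a \<cdot>\<^sub>m (P * B) - b \<cdot>\<^sub>m 1\<^sub>m n"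
    using c PA by (simp add: mult_minus_distrib_mat[of _ n n _ n] mult_smult_distrib[of _ n n _ n])
  moreover have PB: "P * B \<in> carrier_mat n n" using c by simp
  moreover have "(P * B) * Q = P"
    using c BQ by (simp add: assoc_mult_mat[of _ n n _ n _ n])
  ultimately show ?thesis
    using c by (simp add: minus_mult_distrib_mat[of _ n n _ _ n] mult_smult_assoc_mat[of _ n n _ n])
qed

text \<open>The weighted resolvent identity between the output and input matrices. The weights cross
  over: the factor of the transfer function at \<mu> multiplies the pencil at \<nu>.\<close>

lemma transfer_function_divided_difference:
  fixes Sys :: so_system
  assumes pen: "pencil Sys \<mu> \<in> carrier_mat n n" "pencil Sys \<nu> \<in> carrier_mat n n"
    and det: "det (pencil Sys \<mu>) \<noteq> 0" "det (pencil Sys \<nu>) \<noteq> 0"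
    and C: "output_mat Sys \<in> carrier_mat m n" and B: "input_mat Sys \<in> carrier_mat n m"
    and E: "E \<in> carrier_mat n n" and eq: "a \<cdot>\<^sub>m pencil Sys \<nu> - b \<cdot>\<^sub>m pencil Sys \<mu> = c \<cdot>\<^sub>m E"
  shows "a \<cdot>\<^sub>m transfer_function Sys \<mu> - b \<cdot>\<^sub>m transfer_function Sys \<nu> =
    c \<cdot>\<^sub>m ((output_mat Sys * the (mat_inverse (pencil Sys \<mu>))) * E
          * (the (mat_inverse (pencil Sys \<nu>)) * input_mat Sys))"
proof -
  let ?P = "the (mat_inverse (pencil Sys \<mu>))" and ?Q = "the (mat_inverse (pencil Sys \<nu>))"
  let ?C = "output_mat Sys" and ?B = "input_mat Sys"
  note P = mat_inverse_det_nonzero[OF pen(1) det(1)] and Q = mat_inverse_det_nonzero[OF pen(2) det(2)]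
  have PE: "?P * E \<in> carrier_mat n n" and CP: "?C * ?P \<in> carrier_mat m n"
    and CQ: "?C * ?Q \<in> carrier_mat m n" and QB: "?Q * ?B \<in> carrier_mat n m"
    using P Q C B E by (auto intro!: mult_carrier_mat)
  have PEQ: "?P * E * ?Q \<in> carrier_mat n n" by (rule mult_carrier_mat[OF PE Q(1)])
  have "a \<cdot>\<^sub>m transfer_function Sys \<mu> - b \<cdot>\<^sub>m transfer_function Sys \<nu>
      = ?C * (a \<cdot>\<^sub>m ?P - b \<cdot>\<^sub>m ?Q) * ?B"
    using P(1) Q(1) C B CP CQ unfolding transfer_function_def
    by (simp add: mult_minus_distrib_mat[of _ m n _ n] minus_mult_distrib_mat[of _ m n _ _ m]
        mult_smult_distrib[of _ m n _ n] mult_smult_assoc_mat[of _ m n _ m])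
  also have "a \<cdot>\<^sub>m ?P - b \<cdot>\<^sub>m ?Q = ?P * (c \<cdot>\<^sub>m E) * ?Q"
    using resolvent_identity[OF pen P(1) Q(1) P(3) Q(2)] eq by simp
  also have "\<dots> = c \<cdot>\<^sub>m (?P * E * ?Q)"
    using mult_smult_distrib[OF P(1) E] mult_smult_assoc_mat[OF PE Q(1)] by simp
  also have "?C * (c \<cdot>\<^sub>m (?P * E * ?Q)) * ?B = c \<cdot>\<^sub>m (?C * (?P * E * ?Q) * ?B)"
    using C B PEQ by (simp add: mult_smult_distrib[of _ m n _ n] mult_smult_assoc_mat[of _ m n _ m])
  also have "?C * (?P * E * ?Q) * ?B = ?C * ?P * E * (?Q * ?B)"
  proof -
    have CPE: "?C * ?P * E \<in> carrier_mat m n" by (rule mult_carrier_mat[OF CP E])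
    have "?C * (?P * E * ?Q) = ?C * ?P * E * ?Q"
      using assoc_mult_mat[OF C PE Q(1)] assoc_mult_mat[OF C P(1) E] by simp
    then show ?thesis using assoc_mult_mat[OF CPE Q(1) B] by simp
  qed
  finally show ?thesis .
qed

section \<open>Transfer functions of systems with Rayleigh damping\<close>

lemma d_fun_h_fun: "d_fun \<beta> z \<noteq> 0 \<Longrightarrow> d_fun \<beta> z * h_fun \<alpha> \<beta> z = n_fun \<alpha> z"
  by (simp add: h_fun_def)

lemma h_fun_field_differentiable:
  "d_fun \<beta> z \<noteq> 0 \<Longrightarrow> h_fun \<alpha> \<beta> field_differentiable at z"
  unfolding h_fun_def[abs_def] n_fun_def d_fun_def by (auto intro!: derivative_intros)

text \<open>Collects what the representation of the data matrices rests on: self-adjoint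
  coefficients, Rayleigh damping, and an input matrix adjoint to the output matrix.\<close>

locale rayleigh_system =
  fixes n m :: nat and \<alpha> \<beta> :: real and Sys :: so_system
  assumes M: "mass Sys \<in> carrier_mat n n" "mat_adjoint (mass Sys) = mass Sys"
    and K: "stiffness Sys \<in> carrier_mat n n" "mat_adjoint (stiffness Sys) = stiffness Sys"
    and D: "damping Sys = of_real \<alpha> \<cdot>\<^sub>m mass Sys + of_real \<beta> \<cdot>\<^sub>m stiffness Sys"
    and C: "output_mat Sys \<in> carrier_mat m n"
    and B: "input_mat Sys = mat_adjoint (output_mat Sys)"
begin

abbreviation "R z \<equiv> the (mat_inverse (pencil Sys z))"

lemma pencil_eq: "pencil Sys z = n_fun \<alpha> z \<cdot>\<^sub>m mass Sys + d_fun \<beta> z \<cdot>\<^sub>m stiffness Sys"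
  using M K by (intro eq_matI) (auto simp: pencil_def D n_fun_def d_fun_def algebra_simps)

lemma pencil_carrier: "pencil Sys z \<in> carrier_mat n n"
  using M K by (simp add: pencil_eq)

lemma B_carrier: "input_mat Sys \<in> carrier_mat n m"
  using C by (simp add: B)

lemma pencil_cnj: "pencil Sys (cnj z) = mat_adjoint (pencil Sys z)"
  using M K by (simp add: pencil_eq mat_adjoint_add[of _ n n] mat_adjoint_smult n_fun_def d_fun_def)

text \<open>The mass terms cancel, and \<open>n = d * h\<close> turns the remaining coefficient into
  a difference of \<open>h\<close>. The factor 1 is kept to match the sign \<open>e\<close> of
  \<open>loewner_block\<close>.\<close>

lemma pencil_n_fun_combination:
  assumes "d_fun \<beta> \<mu> \<noteq> 0" "d_fun \<beta> \<nu> \<noteq> 0"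
  shows "n_fun \<alpha> \<mu> \<cdot>\<^sub>m pencil Sys \<nu> - n_fun \<alpha> \<nu> \<cdot>\<^sub>m pencil Sys \<mu>
    = (1 * (h_fun \<alpha> \<beta> \<mu> - h_fun \<alpha> \<beta> \<nu>) * d_fun \<beta> \<mu> * d_fun \<beta> \<nu>) \<cdot>\<^sub>m stiffness Sys"
  using M K
  by (intro eq_matI)
    (auto simp: pencil_eq d_fun_h_fun[OF assms(1), of \<alpha>, symmetric]
      d_fun_h_fun[OF assms(2), of \<alpha>, symmetric] algebra_simps)

text \<open>Here the stiffness terms cancel instead, and the sign is reversed.\<close>

lemma pencil_d_fun_combination:
  assumes "d_fun \<beta> \<mu> \<noteq> 0" "d_fun \<beta> \<nu> \<noteq> 0"
  shows "d_fun \<beta> \<mu> \<cdot>\<^sub>m pencil Sys \<nu> - d_fun \<beta> \<nu> \<cdot>\<^sub>m pencil Sys \<mu>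
    = (- 1 * (h_fun \<alpha> \<beta> \<mu> - h_fun \<alpha> \<beta> \<nu>) * d_fun \<beta> \<mu> * d_fun \<beta> \<nu>) \<cdot>\<^sub>m mass Sys"
  using M K
  by (intro eq_matI)
    (auto simp: pencil_eq d_fun_h_fun[OF assms(1), of \<alpha>, symmetric]
      d_fun_h_fun[OF assms(2), of \<alpha>, symmetric] algebra_simps)

lemma pencil_tendsto:
  "i < n \<Longrightarrow> j < n \<Longrightarrow> ((\<lambda>z. pencil Sys z $$ (i, j)) \<longlongrightarrow> pencil Sys \<nu> $$ (i, j)) (at \<nu>)"
  using M K by (auto simp: pencil_eq n_fun_def d_fun_def intro!: tendsto_intros)

lemma det_pencil_tendsto: "((\<lambda>z. det (pencil Sys z)) \<longlongrightarrow> det (pencil Sys \<nu>)) (at \<nu>)"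
  by (rule tendsto_det[OF pencil_carrier pencil_carrier pencil_tendsto])

lemma eventually_det_pencil_nonzero:
  "det (pencil Sys \<nu>) \<noteq> 0 \<Longrightarrow> \<forall>\<^sub>F z in at \<nu>. det (pencil Sys z) \<noteq> 0"
  using tendsto_imp_eventually_ne[OF det_pencil_tendsto] .

lemma eventually_d_fun_nonzero:
  assumes "d_fun \<beta> \<nu> \<noteq> 0"
  shows "\<forall>\<^sub>F z in at \<nu>. d_fun \<beta> z \<noteq> 0"
proof -
  have "((\<lambda>z. d_fun \<beta> z) \<longlongrightarrow> d_fun \<beta> \<nu>) (at \<nu>)"
    unfolding d_fun_def by (intro tendsto_intros)
  then show ?thesis by (rule tendsto_imp_eventually_ne[OF _ assms])
qed

text \<open>Cramer's rule describes \<open>R z\<close> only where the pencil is nonsingular, which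
  holds near \<nu> by continuity of the determinant.\<close>

lemma resolvent_tendsto:
  assumes "det (pencil Sys \<nu>) \<noteq> 0" "i < n" "j < n"
  shows "((\<lambda>z. R z $$ (i, j)) \<longlongrightarrow> R \<nu> $$ (i, j)) (at \<nu>)"
proof -
  have "((\<lambda>z. adj_mat (pencil Sys z) $$ (i, j) / det (pencil Sys z)) \<longlongrightarrow>
      adj_mat (pencil Sys \<nu>) $$ (i, j) / det (pencil Sys \<nu>)) (at \<nu>)"
    using assms by (intro tendsto_divide det_pencil_tendsto tendsto_adj_mat[OF pencil_carrier]
      pencil_carrier pencil_tendsto)
  moreover have "\<forall>\<^sub>F z in at \<nu>.
      adj_mat (pencil Sys z) $$ (i, j) / det (pencil Sys z) = R z $$ (i, j)"
    using eventually_det_pencil_nonzero[OF assms(1)]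
    by eventually_elim (rule mat_inverse_det_nonzero(4)[OF pencil_carrier _ assms(2,3), symmetric])
  ultimately show ?thesis
    using mat_inverse_det_nonzero(4)[OF pencil_carrier assms] by (auto intro: Lim_transform_eventually)
qed

lemma transfer_function_dim [simp]:
  "dim_row (transfer_function Sys z) = m" "dim_col (transfer_function Sys z) = m"
  using C by (auto simp: transfer_function_def B)

abbreviation block where
  "block E \<mu> \<nu> \<equiv> output_mat Sys * R \<mu> * E * (R \<nu> * input_mat Sys)"

lemma block_carrier:
  assumes "det (pencil Sys \<mu>) \<noteq> 0" "det (pencil Sys \<nu>) \<noteq> 0" "E \<in> carrier_mat n n"
  shows "block E \<mu> \<nu> \<in> carrier_mat m m"
  using mat_inverse_det_nonzero(1)[OF pencil_carrier] assms C B_carrier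
  by (intro mult_carrier_mat) auto

text \<open>\<open>(fG)'\<close> is the limit of the divided differences of \<open>fG\<close>.\<close>

lemma mat_deriv_transfer_function:
  assumes d: "d_fun \<beta> \<nu> \<noteq> 0" and det: "det (pencil Sys \<nu>) \<noteq> 0" and E: "E \<in> carrier_mat n n"
    and f: "\<And>z. d_fun \<beta> z \<noteq> 0 \<Longrightarrow> f z \<cdot>\<^sub>m pencil Sys \<nu> - f \<nu> \<cdot>\<^sub>m pencil Sys z
      = (e * (h_fun \<alpha> \<beta> z - h_fun \<alpha> \<beta> \<nu>) * d_fun \<beta> z * d_fun \<beta> \<nu>) \<cdot>\<^sub>m E"
  shows "mat_deriv (\<lambda>z. f z \<cdot>\<^sub>m transfer_function Sys z) \<nu>
    = (e * deriv (h_fun \<alpha> \<beta>) \<nu> * (d_fun \<beta> \<nu>)\<^sup>2) \<cdot>\<^sub>m block E \<nu> \<nu>"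
proof (rule eq_matI)
  note bc = block_carrier[OF det det E]
  show "dim_row (mat_deriv (\<lambda>z. f z \<cdot>\<^sub>m transfer_function Sys z) \<nu>)
      = dim_row ((e * deriv (h_fun \<alpha> \<beta>) \<nu> * (d_fun \<beta> \<nu>)\<^sup>2) \<cdot>\<^sub>m block E \<nu> \<nu>)"
    "dim_col (mat_deriv (\<lambda>z. f z \<cdot>\<^sub>m transfer_function Sys z) \<nu>)
      = dim_col ((e * deriv (h_fun \<alpha> \<beta>) \<nu> * (d_fun \<beta> \<nu>)\<^sup>2) \<cdot>\<^sub>m block E \<nu> \<nu>)"
    using bc by (auto simp: mat_deriv_def)
  fix a b
  assume "a < dim_row ((e * deriv (h_fun \<alpha> \<beta>) \<nu> * (d_fun \<beta> \<nu>)\<^sup>2) \<cdot>\<^sub>m block E \<nu> \<nu>)"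
    "b < dim_col ((e * deriv (h_fun \<alpha> \<beta>) \<nu> * (d_fun \<beta> \<nu>)\<^sup>2) \<cdot>\<^sub>m block E \<nu> \<nu>)"
  then have ab: "a < m" "b < m" using bc by auto
  define g where "g = (\<lambda>z. (f z \<cdot>\<^sub>m transfer_function Sys z) $$ (a, b))"
  have Rc: "R z \<in> carrier_mat n n" if "det (pencil Sys z) \<noteq> 0" for z
    using mat_inverse_det_nonzero(1)[OF pencil_carrier that] .
  have QB: "E * (R \<nu> * input_mat Sys) \<in> carrier_mat n m"
    using E Rc[OF det] B_carrier by (intro mult_carrier_mat)
  \<comment> \<open>Only the left resolvent depends on \<open>z\<close>, so each entry is a fixed
    linear combination of entries of \<open>R z\<close> and limits pass through the sum.\<close>
  have entry: "block E z \<nu> $$ (a, b) = (\<Sum>l<n. (\<Sum>i<n. output_mat Sys $$ (a, i) * R z $$ (i, l))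
      * (E * (R \<nu> * input_mat Sys)) $$ (l, b))" if "det (pencil Sys z) \<noteq> 0" for z
  proof -
    have "block E z \<nu> = output_mat Sys * R z * (E * (R \<nu> * input_mat Sys))"
      using C Rc[OF that] Rc[OF det] E B_carrier
      by (intro assoc_mult_mat[of _ m n _ n _ m] mult_carrier_mat[of _ m n] mult_carrier_mat[of _ n n])
    then show ?thesis
      using index_mult3[OF C Rc[OF that] QB ab] by simp
  qed
  have block_lim: "((\<lambda>z. block E z \<nu> $$ (a, b)) \<longlongrightarrow> block E \<nu> \<nu> $$ (a, b)) (at \<nu>)"
  proof (rule Lim_transform_eventually)
    show "((\<lambda>z. \<Sum>l<n. (\<Sum>i<n. output_mat Sys $$ (a, i) * R z $$ (i, l))
      * (E * (R \<nu> * input_mat Sys)) $$ (l, b)) \<longlongrightarrow> block E \<nu> \<nu> $$ (a, b)) (at \<nu>)"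
      unfolding entry[OF det] by (intro tendsto_intros resolvent_tendsto[OF det]) auto
    show "\<forall>\<^sub>F z in at \<nu>. (\<Sum>l<n. (\<Sum>i<n. output_mat Sys $$ (a, i) * R z $$ (i, l))
      * (E * (R \<nu> * input_mat Sys)) $$ (l, b)) = block E z \<nu> $$ (a, b)"
      using eventually_det_pencil_nonzero[OF det] by eventually_elim (rule entry[symmetric])
  qed
  have h_lim: "((\<lambda>z. (h_fun \<alpha> \<beta> z - h_fun \<alpha> \<beta> \<nu>) / (z - \<nu>)) \<longlongrightarrow> deriv (h_fun \<alpha> \<beta>) \<nu>) (at \<nu>)"
    using h_fun_field_differentiable[OF d, of \<alpha>]
    by (simp add: field_differentiable_derivI flip: has_field_derivative_iff)
  have d_lim: "((\<lambda>z. d_fun \<beta> z) \<longlongrightarrow> d_fun \<beta> \<nu>) (at \<nu>)"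
    unfolding d_fun_def by (intro tendsto_intros)
  have "((\<lambda>z. e * ((h_fun \<alpha> \<beta> z - h_fun \<alpha> \<beta> \<nu>) / (z - \<nu>)) * d_fun \<beta> z * d_fun \<beta> \<nu>
      * block E z \<nu> $$ (a, b)) \<longlongrightarrow>
      e * deriv (h_fun \<alpha> \<beta>) \<nu> * d_fun \<beta> \<nu> * d_fun \<beta> \<nu> * block E \<nu> \<nu> $$ (a, b)) (at \<nu>)"
    by (intro tendsto_intros h_lim d_lim block_lim)
  \<comment> \<open>Away from \<nu> but close to it, the resolvent identity gives the difference
    quotient exactly.\<close>
  moreover have "\<forall>\<^sub>F z in at \<nu>. e * ((h_fun \<alpha> \<beta> z - h_fun \<alpha> \<beta> \<nu>) / (z - \<nu>)) * d_fun \<beta> z * d_fun \<beta> \<nu>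
      * block E z \<nu> $$ (a, b) = (g z - g \<nu>) / (z - \<nu>)"
    using eventually_det_pencil_nonzero[OF det] eventually_d_fun_nonzero[OF d]
  proof eventually_elim
    case (elim z)
    have "g z - g \<nu> = (f z \<cdot>\<^sub>m transfer_function Sys z - f \<nu> \<cdot>\<^sub>m transfer_function Sys \<nu>) $$ (a, b)"
      using ab by (simp add: g_def)
    also have "\<dots> = e * (h_fun \<alpha> \<beta> z - h_fun \<alpha> \<beta> \<nu>) * d_fun \<beta> z * d_fun \<beta> \<nu> * block E z \<nu> $$ (a, b)"
      unfolding transfer_function_divided_difference[OF pencil_carrier pencil_carrier elim(1) det C
          B_carrier E f[OF elim(2)]]
      using ab carrier_matD[OF block_carrier[OF elim(1) det E]]
      by (intro index_smult_mat(1)) simp_all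
    finally show ?case by simp
  qed
  ultimately have "((\<lambda>z. (g z - g \<nu>) / (z - \<nu>)) \<longlongrightarrow>
      e * deriv (h_fun \<alpha> \<beta>) \<nu> * d_fun \<beta> \<nu> * d_fun \<beta> \<nu> * block E \<nu> \<nu> $$ (a, b)) (at \<nu>)"
    by (rule Lim_transform_eventually)
  \<comment> \<open>The limit proves differentiability of \<open>g\<close> along with the value, so
    \<open>deriv\<close> is a genuine derivative here.\<close>
  then have "deriv g \<nu> = e * deriv (h_fun \<alpha> \<beta>) \<nu> * d_fun \<beta> \<nu> * d_fun \<beta> \<nu> * block E \<nu> \<nu> $$ (a, b)"
    by (intro DERIV_imp_deriv) (simp add: has_field_derivative_iff)
  then show "mat_deriv (\<lambda>z. f z \<cdot>\<^sub>m transfer_function Sys z) \<nu> $$ (a, b)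
      = ((e * deriv (h_fun \<alpha> \<beta>) \<nu> * (d_fun \<beta> \<nu>)\<^sup>2) \<cdot>\<^sub>m block E \<nu> \<nu>) $$ (a, b)"
    using ab carrier_matD[OF bc]
    by (subst index_smult_mat(1)) (simp_all add: mat_deriv_def g_def power2_eq_square)
qed

text \<open>At a conjugate point the resolvent is the adjoint one, and the output matrix is the
  adjoint of the input matrix. The left factor is thus the adjoint of a right factor, and the real
  weights pass through unchanged.\<close>

lemma block_cnj:
  assumes "det (pencil Sys \<nu>\<^sub>1) \<noteq> 0" "det (pencil Sys (cnj \<nu>\<^sub>1)) \<noteq> 0" "det (pencil Sys \<nu>\<^sub>2) \<noteq> 0"
    "E \<in> carrier_mat n n"
  shows "complex_of_real (x * y) \<cdot>\<^sub>m block E (cnj \<nu>\<^sub>1) \<nu>\<^sub>2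
    = mat_adjoint (of_real x \<cdot>\<^sub>m (R \<nu>\<^sub>1 * input_mat Sys)) * E * (of_real y \<cdot>\<^sub>m (R \<nu>\<^sub>2 * input_mat Sys))"
proof -
  note R1 = mat_inverse_det_nonzero(1)[OF pencil_carrier assms(1)]
    and R2 = mat_inverse_det_nonzero(1)[OF pencil_carrier assms(3)]
  have "R (cnj \<nu>\<^sub>1) = mat_adjoint (R \<nu>\<^sub>1)"
    using mat_inverse_adjoint[OF pencil_carrier assms(1)] assms(2) by (simp add: pencil_cnj)
  moreover have "output_mat Sys = mat_adjoint (input_mat Sys)" by (simp add: B)
  ultimately have "output_mat Sys * R (cnj \<nu>\<^sub>1) = mat_adjoint (R \<nu>\<^sub>1 * input_mat Sys)"
    using mat_adjoint_mult[OF R1 B_carrier] by simp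
  moreover have X1: "mat_adjoint (R \<nu>\<^sub>1 * input_mat Sys) \<in> carrier_mat m n"
    and X2: "R \<nu>\<^sub>2 * input_mat Sys \<in> carrier_mat n m"
    using R1 R2 B_carrier by auto
  moreover have "mat_adjoint (R \<nu>\<^sub>1 * input_mat Sys) * E \<in> carrier_mat m n"
    using X1 assms(4) by (intro mult_carrier_mat)
  moreover have "k \<cdot>\<^sub>m (l \<cdot>\<^sub>m A) = (k * l) \<cdot>\<^sub>m A" for k l :: complex and A
    by (rule eq_matI) (auto simp: mult.assoc)
  ultimately show ?thesis
    using assms(4) by (simp add: mat_adjoint_smult mult_smult_assoc_mat[of _ m n _ n]
        mult_smult_assoc_mat[of _ m n _ m] mult_smult_distrib[of _ m n _ m] mult.commute)
qed

end

section \<open>The data matrices as congruence transforms\<close>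

lemma left_node_eq_cnj: "left_node s k = cnj (right_node s k)"
  by (simp add: left_node_def right_node_def)

context rayleigh_system
begin

text \<open>This is the \<open>V\<close> of the congruences: block column \<open>j\<close> holds the
  weighted resolvent at right node \<open>j\<close> applied to the input matrix.\<close>

definition snapshots :: "nat \<Rightarrow> (nat \<Rightarrow> real) \<Rightarrow> (nat \<Rightarrow> real) \<Rightarrow> complex mat" where
  "snapshots N s \<xi> = Matrix.mat n (m * N) (\<lambda>(i, b).
     (of_real (\<xi> (b div m)) \<cdot>\<^sub>m (R (right_node s (b div m)) * input_mat Sys)) $$ (i, b mod m))"

lemma snapshots_carrier: "snapshots N s \<xi> \<in> carrier_mat n (m * N)"
  by (simp add: snapshots_def)

lemma admissible_det:
  assumes "admissible \<alpha> \<beta> Sys N s" "j < N"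
  shows "det (pencil Sys (right_node s j)) \<noteq> 0" "det (pencil Sys (left_node s j)) \<noteq> 0"
  using assms invertible_mat_imp_det_nonzero[OF pencil_carrier] by (auto simp: admissible_def)

text \<open>Used with \<open>(f, E, e) = (d, M, -1)\<close> for the entries of \<open>MM\<close> and with
  \<open>(f, E, e) = (n, K, 1)\<close> for those of \<open>KK\<close>.\<close>

lemma loewner_block:
  assumes adm: "admissible \<alpha> \<beta> Sys N s" and kj: "k < N" "j < N"
    and \<mu>: "\<mu> = left_node s k" and \<nu>: "\<nu> = right_node s j"
    and E: "E \<in> carrier_mat n n" and e: "e * e = 1"
    and f: "\<And>\<mu> \<nu>. d_fun \<beta> \<mu> \<noteq> 0 \<Longrightarrow> d_fun \<beta> \<nu> \<noteq> 0 \<Longrightarrow> f \<mu> \<cdot>\<^sub>m pencil Sys \<nu> - f \<nu> \<cdot>\<^sub>m pencil Sys \<mu>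
      = (e * (h_fun \<alpha> \<beta> \<mu> - h_fun \<alpha> \<beta> \<nu>) * d_fun \<beta> \<mu> * d_fun \<beta> \<nu>) \<cdot>\<^sub>m E"
  shows "(if \<nu> = \<mu>
      then (e * w / (d_fun \<beta> \<nu>)\<^sup>2 * (1 / deriv (h_fun \<alpha> \<beta>) \<nu>))
        \<cdot>\<^sub>m mat_deriv (\<lambda>z. f z \<cdot>\<^sub>m transfer_function Sys z) \<nu>
      else (e * w / (d_fun \<beta> \<mu> * d_fun \<beta> \<nu>) * (1 / (h_fun \<alpha> \<beta> \<mu> - h_fun \<alpha> \<beta> \<nu>)))
        \<cdot>\<^sub>m (f \<mu> \<cdot>\<^sub>m transfer_function Sys \<mu> - f \<nu> \<cdot>\<^sub>m transfer_function Sys \<nu>))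
    = w \<cdot>\<^sub>m block E \<mu> \<nu>"
proof -
  have det: "det (pencil Sys \<nu>) \<noteq> 0" "det (pencil Sys \<mu>) \<noteq> 0"
    using admissible_det[OF adm] kj \<mu> \<nu> by auto
  have d: "d_fun \<beta> \<nu> \<noteq> 0" "d_fun \<beta> \<mu> \<noteq> 0"
    using adm kj \<mu> \<nu> by (auto simp: admissible_def)
  have smult: "k \<cdot>\<^sub>m (l \<cdot>\<^sub>m A) = (k * l) \<cdot>\<^sub>m A" for k l :: complex and A
    by (rule eq_matI) (auto simp: mult.assoc)
  show ?thesis
  proof (cases "\<nu> = \<mu>")
    case True
    then have "deriv (h_fun \<alpha> \<beta>) \<nu> \<noteq> 0"
      using adm kj \<mu> \<nu> by (auto simp: admissible_def)
    \<comment> \<open>The sign \<open>e\<close> occurs once in the prefactor and once in the divided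
      difference, so it drops out by \<open>e * e = 1\<close>.\<close>
    then have coeff: "e * w / (d_fun \<beta> \<nu>)\<^sup>2 * (1 / deriv (h_fun \<alpha> \<beta>) \<nu>)
        * (e * deriv (h_fun \<alpha> \<beta>) \<nu> * (d_fun \<beta> \<nu>)\<^sup>2) = e * e * w"
      using d by (simp add: field_simps)
    have deriv: "mat_deriv (\<lambda>z. f z \<cdot>\<^sub>m transfer_function Sys z) \<nu>
        = (e * deriv (h_fun \<alpha> \<beta>) \<nu> * (d_fun \<beta> \<nu>)\<^sup>2) \<cdot>\<^sub>m block E \<nu> \<nu>"
      by (rule mat_deriv_transfer_function[OF d(1) det(1) E f[OF _ d(1)]])
    show ?thesis
      unfolding if_P[OF True] deriv smult coeff using True e by simp
  next
    case False
    then have "h_fun \<alpha> \<beta> \<mu> - h_fun \<alpha> \<beta> \<nu> \<noteq> 0"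
      using adm kj \<mu> \<nu> by (auto simp: admissible_def)
    then have "e * w / (d_fun \<beta> \<mu> * d_fun \<beta> \<nu>) * (1 / (h_fun \<alpha> \<beta> \<mu> - h_fun \<alpha> \<beta> \<nu>))
        * (e * (h_fun \<alpha> \<beta> \<mu> - h_fun \<alpha> \<beta> \<nu>) * d_fun \<beta> \<mu> * d_fun \<beta> \<nu>) = e * e * w"
      using d by (simp add: divide_simps)
    then show ?thesis
      using False e transfer_function_divided_difference[OF pencil_carrier pencil_carrier det(2,1) C
          B_carrier E f[OF d(2,1)]]
      by (simp only: smult if_False mult_1_left)
  qed
qed

lemma block_snapshots:
  assumes adm: "admissible \<alpha> \<beta> Sys N s" and E: "E \<in> carrier_mat n n"
  shows "block_mat m N N (\<lambda>k j. complex_of_real (\<xi> k * \<xi> j) \<cdot>\<^sub>m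
      block E (left_node s k) (right_node s j))
    = mat_adjoint (snapshots N s \<xi>) * E * snapshots N s \<xi>"
proof (rule block_mat_congruence[OF E _ snapshots_def])
  show "of_real (\<xi> j) \<cdot>\<^sub>m (R (right_node s j) * input_mat Sys) \<in> carrier_mat n m" if "j < N" for j
    using mat_inverse_det_nonzero(1)[OF pencil_carrier admissible_det(1)[OF adm that]] B_carrier
    by simp
  show "complex_of_real (\<xi> k * \<xi> j) \<cdot>\<^sub>m block E (left_node s k) (right_node s j)
      = mat_adjoint (of_real (\<xi> k) \<cdot>\<^sub>m (R (right_node s k) * input_mat Sys)) * E *
        (of_real (\<xi> j) \<cdot>\<^sub>m (R (right_node s j) * input_mat Sys))" if "k < N" "j < N" for k j
    using admissible_det[OF adm that(1)] admissible_det(1)[OF adm that(2)]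
    unfolding left_node_eq_cnj by (intro block_cnj E)
qed

lemma block_mat_cong:
  assumes "\<And>k j. k < p \<Longrightarrow> j < q \<Longrightarrow> X k j = Z k j"
  shows "block_mat l p q X = block_mat l p q Z"
  using assms
  by (auto simp: block_mat_def less_mult_imp_div_less mult.commute intro!: cong_mat)

lemma data_M_eq:
  assumes adm: "admissible \<alpha> \<beta> Sys N s"
  shows "data_M \<alpha> \<beta> m N s \<xi> (transfer_function Sys)
    = mat_adjoint (snapshots N s \<xi>) * mass Sys * snapshots N s \<xi>"
  unfolding data_M_def Let_def block_snapshots[OF adm M(1), symmetric]
  \<comment> \<open>The choice \<open>e = - 1\<close> yields the prefactor \<open>- 1 * w\<close>,
    which \<open>mult_minus1\<close> rewrites to the \<open>- w\<close> of
    \<open>data_M\<close>.\<close>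
  by (intro block_mat_cong loewner_block[where e = "- 1" and f = "d_fun \<beta>", OF adm _ _ refl refl M(1)
      _ pencil_d_fun_combination, unfolded mult_minus1]) simp_all

lemma data_K_eq:
  assumes adm: "admissible \<alpha> \<beta> Sys N s"
  shows "data_K \<alpha> \<beta> m N s \<xi> (transfer_function Sys)
    = mat_adjoint (snapshots N s \<xi>) * stiffness Sys * snapshots N s \<xi>"
  unfolding data_K_def Let_def block_snapshots[OF adm K(1), symmetric]
  by (intro block_mat_cong loewner_block[where e = 1 and f = "n_fun \<alpha>", OF adm _ _ refl refl K(1)
      _ pencil_n_fun_combination, unfolded mult_1_left]) simp_all

end

section \<open>Stability of the reduced model\<close>

theorem theorem3:
  fixes n m N r :: nat
    and M D K Cp Bu :: "complex mat"
    and \<alpha> \<beta> :: real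
    and s \<xi> \<sigma> :: "nat \<Rightarrow> real"
    and Sys :: so_system
    and G :: "complex \<Rightarrow> complex mat"
    and MM KK BB CC U Y :: "complex mat"
  assumes "hermitian_pos_def n M" and "hermitian_pos_def n D" and "hermitian_pos_def n K"
    and "Cp \<in> carrier_mat m n" and "Bu = mat_adjoint Cp"
    and "0 \<le> \<alpha>" and "0 \<le> \<beta>"
    and "D = of_real \<alpha> \<cdot>\<^sub>m M + of_real \<beta> \<cdot>\<^sub>m K"
    and "Sys = \<lparr> mass = M, damping = D, stiffness = K, input_mat = Bu, output_mat = Cp \<rparr>"
    and "G = transfer_function Sys"
    and "admissible \<alpha> \<beta> Sys N s"
    and "MM = data_M \<alpha> \<beta> m N s \<xi> G" and "KK = data_K \<alpha> \<beta> m N s \<xi> G"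
    and "BB = data_B m N s \<xi> G" and "CC = data_C m N s \<xi> G"
    and "1 \<le> r" and "r \<le> m * N"
    and "is_svd (m * N) r MM U \<sigma> Y"
    and "\<forall>i<r. 0 < \<sigma> i"
  shows "asymptotically_stable (bt_model \<alpha> \<beta> r U \<sigma> Y KK BB CC)"
proof -
  note MDK = assms(1-3)
  have car: "M \<in> carrier_mat n n" "mat_adjoint M = M" "K \<in> carrier_mat n n" "mat_adjoint K = K"
    using MDK by (auto simp: hermitian_pos_def_def)
  interpret rayleigh_system n m \<alpha> \<beta> Sys
    by unfold_locales (use assms car in auto)
  let ?p = "m * N"
  define V where "V = snapshots N s \<xi>"
  have V: "V \<in> carrier_mat n ?p" unfolding V_def by (rule snapshots_carrier)
  have MM: "MM = mat_adjoint V * M * V" and KK: "KK = mat_adjoint V * K * V"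
    using data_M_eq data_K_eq assms unfolding V_def by simp_all
  define S where "S = mat_diag r (\<lambda>i. complex_of_real (\<sigma> i powr (- 1 / 2)))"
  have S: "S \<in> carrier_mat r r" "mat_adjoint S = S"
    unfolding S_def by (simp_all add: mat_adjoint_diag_of_real)
  have U: "U \<in> carrier_mat ?p ?p" and Y: "Y \<in> carrier_mat ?p ?p"
    using assms(18) by (auto simp: is_svd_def unitary_mat_def)
  have cols: "col U i = col Y i" if "i < r" for i
  proof (rule svd_psd_singular_vectors_eq[OF assms(18)])
    show "mat_adjoint MM = MM"
      unfolding MM by (rule mat_adjoint_congruence[OF car(1,2) V])
    show "0 \<le> Re ((MM *\<^sub>v v) \<bullet>c v)" if "v \<in> carrier_vec ?p" for v
      unfolding MM by (rule hermitian_pos_def_congruence_psd[OF MDK(1) V that])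
  qed (use that assms in auto)
  have "U $$ (i, j) = Y $$ (i, j)" if "i < ?p" "j < r" for i j
    using arg_cong[OF cols[OF that(2)], of "\<lambda>v. vec_index v i"] that U Y assms(17) by simp
  then have UY: "first_cols r U = first_cols r Y"
    using U Y by (intro eq_matI) (auto simp: first_cols_def)
  let ?Y = "first_cols r Y"
  have Y1: "?Y \<in> carrier_mat ?p r" using Y by simp
  \<comment> \<open>\<open>S\<close> is real and diagonal, and the leading columns of
    \<open>U\<close> and \<open>Y\<close> agree, so the left truncation matrix is the adjoint of
    \<open>T\<close>.\<close>
  define T where "T = ?Y * S"
  have T: "T \<in> carrier_mat ?p r" unfolding T_def by (rule mult_carrier_mat[OF Y1 S(1)])
  have reduce: "mat_adjoint T * X * T = S * mat_adjoint ?Y * X * ?Y * S"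
    if X: "X \<in> carrier_mat ?p ?p" for X
  proof -
    have "S * mat_adjoint ?Y * X \<in> carrier_mat r ?p"
      using S X Y1 by (intro mult_carrier_mat[of _ r ?p] mult_carrier_mat[of _ r r]) auto
    from assoc_mult_mat[OF this Y1 S(1)] show ?thesis
      unfolding T_def mat_adjoint_mult[OF Y1 S(1)] S(2) by simp
  qed
  define W where "W = V * T"
  have W: "W \<in> carrier_mat n r" unfolding W_def by (rule mult_carrier_mat[OF V T])
  have data_carrier: "mat_adjoint V * X * V \<in> carrier_mat ?p ?p" if "X \<in> carrier_mat n n" for X
    using that V by (intro mult_carrier_mat[of _ ?p n]) auto
  have WM: "mat_adjoint W * M * W = 1\<^sub>m r"
  proof -
    have MMc: "MM \<in> carrier_mat ?p ?p" unfolding MM by (rule data_carrier[OF car(1)])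
    have "mat_adjoint W * M * W = S * mat_adjoint ?Y * MM * ?Y * S"
      unfolding W_def congruence_mult[OF car(1) V T] MM[symmetric] by (rule reduce[OF MMc])
    also have "\<dots> = S * (mat_adjoint ?Y * MM * ?Y) * S"
    proof -
      have YM: "mat_adjoint ?Y * MM \<in> carrier_mat r ?p"
        using Y1 MMc by (intro mult_carrier_mat) auto
      have "S * mat_adjoint ?Y * MM = S * (mat_adjoint ?Y * MM)"
        using S Y1 MMc by (intro assoc_mult_mat) auto
      then show ?thesis using assoc_mult_mat[OF S(1) YM Y1] by simp
    qed
    \<comment> \<open>The decomposition has \<open>U\<close> on the left; \<open>UY\<close>
      exchanges it for \<open>Y\<close>.\<close>
    also have "mat_adjoint ?Y * MM * ?Y = mat_diag r (\<lambda>i. of_real (\<sigma> i))"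
      using svd_first_singular_values[OF assms(18,17)] UY by simp
    also have "S * mat_diag r (\<lambda>i. of_real (\<sigma> i)) * S
        = mat_diag r (\<lambda>i. of_real (\<sigma> i powr (- 1 / 2) * \<sigma> i * \<sigma> i powr (- 1 / 2)))"
      by (simp add: S_def)
    also have "\<dots> = 1\<^sub>m r"
    proof (rule eq_matI)
      fix i j assume "i < dim_row (1\<^sub>m r :: complex mat)" "j < dim_col (1\<^sub>m r :: complex mat)"
      then have ij: "i < r" "j < r" by simp_all
      have "\<sigma> j powr (- 1 / 2) * \<sigma> j * \<sigma> j powr (- 1 / 2) = \<sigma> j powr (- 1) * \<sigma> j"
        by (simp add: powr_add[symmetric] mult.commute mult.left_commute)
      \<comment> \<open>Since \<open>powr\<close> sends 0 to 0, the product is 1 only because the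
        retained singular values are positive.\<close>
      also have "\<dots> = 1" using assms(19)[rule_format, OF ij(2)] by (simp add: powr_minus)
      finally have "complex_of_real (\<sigma> j powr (- 1 / 2) * \<sigma> j * \<sigma> j powr (- 1 / 2)) = 1"
        by (simp only: of_real_1)
      then show "mat_diag r (\<lambda>i. of_real (\<sigma> i powr (- 1 / 2) * \<sigma> i * \<sigma> i powr (- 1 / 2))) $$ (i, j)
          = (1\<^sub>m r :: complex mat) $$ (i, j)"
        using ij by (simp add: mat_diag_def)
    qed (simp_all add: mat_diag_def)
    finally show ?thesis .
  qed
  let ?red = "bt_model \<alpha> \<beta> r U \<sigma> Y KK BB CC"
  have KKc: "KK \<in> carrier_mat ?p ?p" unfolding KK by (rule data_carrier[OF car(3)])
  have "stiffness ?red = S * mat_adjoint ?Y * KK * ?Y * S"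
    by (simp add: bt_model_def Let_def UY S_def)
  also have "\<dots> = mat_adjoint T * KK * T"
    by (rule reduce[OF KKc, symmetric])
  also have "\<dots> = mat_adjoint W * K * W"
    unfolding KK W_def by (rule congruence_mult[OF car(3) V T, symmetric])
  finally show ?thesis
    by (intro asymptotically_stable_congruence[OF MDK assms(8) W WM])
      (simp_all add: bt_model_def Let_def)
qed

end
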